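(* Let $n\ge 1$ be an integer. A finite metric tree with more than $2^n$ leaves cannot be embedded isometrically into $(\mathbb{R}^n,d_\infty)$.
   Context: Finite metric tree: take a finite connected graph without cycles (a finite tree in the sense of graph theory) whose edges carry positive real weights and which has no vertex of degree 2. The finite metric tree is the metric space consisting of all points of the geometric realization of this graph, where each edge is identified with a closed interval whose length is the weight of the edge. The distance between two vertices is the total weight of the unique simple path joining them, and the distance between two arbitrary points (possibly interior to edges) is the length of the unique simple path joining them, taking into account the corresponding portions of the edges carrying these points. A leaf is a vertex of degree 1. The metric $d_\infty$ on $\mathbb{R}^n$ is the maximum metric $d_\infty(x,y)=\max_{1\le i\le n}|x_i-y_i|$. An isometric embedding is a distance-preserving map (not necessarily surjective) defined on the whole metric tree (all points, not only vertices). *)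

theory Defs
  imports "HOL-Analysis.Analysis"
begin

section \<open>Finite trees\<close>

text \<open>
  A graph is given by a vertex set \<open>V\<close> and a set \<open>E\<close> of two-element subsets of \<open>V\<close>.
  (\<open>Graph_Theory.tree\<close> is about directed cycles: a symmetric digraph with an edge is never
  a tree there.)
\<close>

definition finite_graph :: "'a set \<Rightarrow> 'a set set \<Rightarrow> bool" where
  "finite_graph V E \<longleftrightarrow> finite V \<and> V \<noteq> {} \<and> (\<forall>e\<in>E. e \<subseteq> V \<and> card e = 2)"

definition simple_path :: "'a set \<Rightarrow> 'a set set \<Rightarrow> 'a \<Rightarrow> 'a list \<Rightarrow> 'a \<Rightarrow> bool" where
  "simple_path V E u vs v \<longleftrightarrow>
     vs \<noteq> [] \<and> hd vs = u \<and> last vs = v \<and> set vs \<subseteq> V \<and> distinct vs \<and>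
     successively (\<lambda>a b. {a, b} \<in> E) vs"

definition connected_graph :: "'a set \<Rightarrow> 'a set set \<Rightarrow> bool" where
  "connected_graph V E \<longleftrightarrow> (\<forall>u\<in>V. \<forall>v\<in>V. \<exists>vs. simple_path V E u vs v)"

definition graph_cycle :: "'a set \<Rightarrow> 'a set set \<Rightarrow> 'a list \<Rightarrow> bool" where
  "graph_cycle V E vs \<longleftrightarrow>
     length vs \<ge> 3 \<and> set vs \<subseteq> V \<and> distinct vs \<and>
     successively (\<lambda>a b. {a, b} \<in> E) vs \<and> {last vs, hd vs} \<in> E"

definition finite_tree :: "'a set \<Rightarrow> 'a set set \<Rightarrow> bool" where
  "finite_tree V E \<longleftrightarrow>
     finite_graph V E \<and> connected_graph V E \<and> (\<nexists>vs. graph_cycle V E vs)"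

definition vertex_degree :: "'a set set \<Rightarrow> 'a \<Rightarrow> nat" where
  "vertex_degree E v = card {e \<in> E. v \<in> e}"

definition leaves :: "'a set \<Rightarrow> 'a set set \<Rightarrow> 'a set" where
  "leaves V E = {v \<in> V. vertex_degree E v = 1}"


section \<open>Finite metric trees\<close>

definition finite_metric_tree :: "'a set \<Rightarrow> 'a set set \<Rightarrow> ('a set \<Rightarrow> real) \<Rightarrow> bool" where
  "finite_metric_tree V E w \<longleftrightarrow>
     finite_tree V E \<and> (\<forall>v\<in>V. vertex_degree E v \<noteq> 2) \<and> (\<forall>e\<in>E. w e > 0)"

text \<open>
  Points of the geometric realization are given by barycentric coordinates: functions on the
  vertices whose support, the carrier of the point, is a single vertex (the point is that
  vertex) or an edge (the point is interior to that edge).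
\<close>

definition carrier_of :: "('a \<Rightarrow> real) \<Rightarrow> 'a set" where
  "carrier_of x = {v. x v \<noteq> 0}"

definition realization :: "'a set \<Rightarrow> 'a set set \<Rightarrow> ('a \<Rightarrow> real) set" where
  "realization V E =
     {x. (\<forall>v. 0 \<le> x v) \<and> ((\<exists>v\<in>V. carrier_of x = {v}) \<or> carrier_of x \<in> E) \<and>
         sum x (carrier_of x) = 1}"

text \<open>
  On an edge \<open>e\<close>, identified with an interval of length \<open>w e\<close>, two points at distance \<open>d\<close>
  differ by \<open>d / w e\<close> in both of their (complementary) barycentric coordinates.  Hence the
  part of the carrier of \<open>x\<close> between \<open>x\<close> and its endpoint \<open>v\<close> has length
  \<open>w (carrier_of x) * (1 - x v)\<close>.  If \<open>x\<close> is the vertex \<open>v\<close>, this is \<open>0\<close>, whatever the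
  irrelevant number \<open>w {v}\<close> is.
\<close>

definition portion :: "('a set \<Rightarrow> real) \<Rightarrow> ('a \<Rightarrow> real) \<Rightarrow> 'a \<Rightarrow> real" where
  "portion w x v = w (carrier_of x) * (1 - x v)"

definition segment_length :: "('a set \<Rightarrow> real) \<Rightarrow> ('a \<Rightarrow> real) \<Rightarrow> ('a \<Rightarrow> real) \<Rightarrow> real" where
  "segment_length w x y = w (carrier_of x) * (MAX v\<in>carrier_of x. \<bar>x v - y v\<bar>)"

fun path_weight :: "('a set \<Rightarrow> real) \<Rightarrow> 'a list \<Rightarrow> real" where
  "path_weight w (u # v # vs) = w {u, v} + path_weight w (v # vs)"
| "path_weight w _ = 0"

text \<open>
  Two points with the same carrier are joined by a segment of that carrier.  If the carriers
  differ, the simple path from \<open>x\<close> to \<open>y\<close> leaves the carrier of \<open>x\<close> at one of its vertices,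
  runs along a simple path \<open>vs\<close> of the graph, and enters the carrier of \<open>y\<close> at the last vertex
  of \<open>vs\<close>; simplicity means that \<open>vs\<close> has no other vertex in common with the two carriers.
\<close>

definition joining_path ::
  "'a set \<Rightarrow> 'a set set \<Rightarrow> ('a \<Rightarrow> real) \<Rightarrow> 'a list \<Rightarrow> ('a \<Rightarrow> real) \<Rightarrow> bool" where
  "joining_path V E x vs y \<longleftrightarrow>
     simple_path V E (hd vs) vs (last vs) \<and>
     set vs \<inter> carrier_of x = {hd vs} \<and> set vs \<inter> carrier_of y = {last vs}"

definition tree_dist ::
  "'a set \<Rightarrow> 'a set set \<Rightarrow> ('a set \<Rightarrow> real) \<Rightarrow> ('a \<Rightarrow> real) \<Rightarrow> ('a \<Rightarrow> real) \<Rightarrow> real" where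
  "tree_dist V E w x y =
     (if carrier_of x = carrier_of y then segment_length w x y
      else let vs = (THE vs. joining_path V E x vs y)
           in portion w x (hd vs) + path_weight w vs + portion w y (last vs))"


section \<open>The maximum metric and isometric embeddings\<close>

definition max_dist :: "real ^ 'n \<Rightarrow> real ^ 'n \<Rightarrow> real" where
  "max_dist x y = (MAX i. \<bar>x $ i - y $ i\<bar>)"

definition isometric_embedding ::
  "'b set \<Rightarrow> ('b \<Rightarrow> 'b \<Rightarrow> real) \<Rightarrow> ('c \<Rightarrow> 'c \<Rightarrow> real) \<Rightarrow> ('b \<Rightarrow> 'c) \<Rightarrow> bool" where
  "isometric_embedding X d d' f \<longleftrightarrow> (\<forall>x\<in>X. \<forall>y\<in>X. d' (f x) (f y) = d x y)"


section \<open>Uniqueness of simple paths; the distance is well defined\<close>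

lemma two_paths_cycle:
  assumes "successively (\<lambda>a b. {a, b} \<in> E) (u # a # as)" "successively (\<lambda>a b. {a, b} \<in> E) (u # b # bs)"
    and "distinct (u # a # as)" "distinct (u # b # bs)" "a \<noteq> b"
    and "last (a # as) = last (b # bs)"
    and "set (u # a # as) \<subseteq> V" "set (u # b # bs) \<subseteq> V"
  shows "\<exists>vs. graph_cycle V E vs"
proof -
  have "\<exists>z\<in>set (a # as). z \<in> set (b # bs)"
    using assms(6) by (metis last_in_set list.distinct(1))
  then obtain p z s where ps: "a # as = p @ z # s" "z \<in> set (b # bs)" "\<forall>x\<in>set p. x \<notin> set (b # bs)"
    using split_list_first_prop[of "a # as" "\<lambda>z. z \<in> set (b # bs)"] by blast
  obtain q r where qr: "b # bs = q @ z # r"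
    using ps(2) by (meson split_list)
  let ?c = "(u # p @ [z]) @ rev q"
  have "p \<noteq> [] \<or> q \<noteq> []" using ps(1) qr assms(5) by auto
  then have "length ?c \<ge> 3" by (cases p; cases q; simp)
  moreover have sub: "set p \<subseteq> set (a # as)" "set q \<subseteq> set (b # bs)" "z \<in> set (a # as)"
    using ps(1) qr by auto
  moreover have "distinct ?c"
  proof -
    have "distinct (u # p @ z # s)" "distinct (u # q @ z # r)"
      using assms(3,4) ps(1) qr by auto
    moreover have "set p \<inter> set q = {}" using ps(3) sub(2) by blast
    ultimately show ?thesis by auto
  qed
  moreover have "set ?c \<subseteq> V" using sub assms(7,8) by auto
  moreover have s1: "successively (\<lambda>a b. {a, b} \<in> E) (u # p @ [z] @ s)"
    and s2: "successively (\<lambda>a b. {a, b} \<in> E) (u # q @ [z] @ r)"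
    using assms(1,2) ps(1) qr by auto
  have "successively (\<lambda>a b. {a, b} \<in> E) ?c"
  proof -
    have "successively (\<lambda>a b. {a, b} \<in> E) (u # p @ [z])"
      using s1 successively_append_iff[of "\<lambda>a b. {a, b} \<in> E" "u # p @ [z]" s] by simp
    moreover have "successively (\<lambda>a b. {a, b} \<in> E) (rev q)"
      using s2 successively_append_iff[of "\<lambda>a b. {a, b} \<in> E" q "[z] @ r"]
      by (auto simp: successively_Cons insert_commute)
    moreover have "q \<noteq> [] \<Longrightarrow> {last q, z} \<in> E"
      using s2 successively_append_iff[of "\<lambda>a b. {a, b} \<in> E" "u # q" "[z] @ r"] by simp
    ultimately show ?thesis
      using successively_append_iff[of "\<lambda>a b. {a, b} \<in> E" "u # p @ [z]" "rev q"]
      by (auto simp del: successively_rev simp: insert_commute hd_rev)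
  qed
  moreover have "{last ?c, hd ?c} \<in> E"
    using s2 by (cases q) (auto simp: insert_commute)
  ultimately show ?thesis unfolding graph_cycle_def by blast
qed

lemma simple_path_unique:
  assumes "\<nexists>vs. graph_cycle V E vs" "simple_path V E u vs v" "simple_path V E u ws v"
  shows "vs = ws"
  using assms(2,3)
proof (induction vs arbitrary: u ws)
  case Nil
  then show ?case by (simp add: simple_path_def)
next
  case (Cons x xs)
  then have xu: "x = u" by (simp add: simple_path_def)
  from Cons.prems(2) obtain ys where ws: "ws = u # ys"
    by (cases ws) (auto simp: simple_path_def)
  show ?case
  proof (cases "xs = [] \<or> ys = []")
    case True
    then show ?thesis using Cons.prems xu ws
      by (metis distinct.simps(2) last.simps last_in_set simple_path_def)
  next
    case False
    then obtain a as b bs where ab: "xs = a # as" "ys = b # bs"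
      by (meson neq_Nil_conv)
    have "a = b"
    proof (rule ccontr)
      assume "a \<noteq> b"
      then show False
        using two_paths_cycle[of E u a as b bs V] Cons.prems xu ws ab assms(1)
        by (auto simp: simple_path_def)
    qed
    moreover have "simple_path V E a xs v" "simple_path V E b ys v"
      using Cons.prems xu ws ab by (auto simp: simple_path_def)
    ultimately show ?thesis using Cons.IH xu ws by blast
  qed
qed

lemma simple_path_Cons:
  assumes "simple_path V E u vs v" "{a, u} \<in> E" "a \<in> V" "a \<notin> set vs"
  shows "simple_path V E a (a # vs) v"
  using assms by (auto simp: simple_path_def successively_Cons)

lemma simple_path_snoc:
  assumes "simple_path V E u vs v" "{v, b} \<in> E" "b \<in> V" "b \<notin> set vs"
  shows "simple_path V E u (vs @ [b]) b"
  using assms by (auto simp: simple_path_def successively_append_iff)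

lemma realization_carrier:
  assumes "finite_graph V E" "x \<in> realization V E"
  shows "carrier_of x \<subseteq> V" "carrier_of x \<noteq> {}" "finite (carrier_of x)"
    and "a \<in> carrier_of x \<Longrightarrow> b \<in> carrier_of x \<Longrightarrow> a \<noteq> b \<Longrightarrow> carrier_of x = {a, b} \<and> {a, b} \<in> E"
proof -
  have *: "(\<exists>v\<in>V. carrier_of x = {v}) \<or> (carrier_of x \<in> E \<and> carrier_of x \<subseteq> V \<and> card (carrier_of x) = 2)"
    using assms by (auto simp: finite_graph_def realization_def)
  then show "carrier_of x \<subseteq> V" "carrier_of x \<noteq> {}" "finite (carrier_of x)"
    by (auto intro: card_ge_0_finite)
  show "carrier_of x = {a, b} \<and> {a, b} \<in> E"
    if "a \<in> carrier_of x" "b \<in> carrier_of x" "a \<noteq> b"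
    using * that by (auto simp: card_2_iff insert_commute)
qed

lemma joining_path_exists:
  assumes "finite_tree V E" "x \<in> realization V E" "y \<in> realization V E"
  shows "\<exists>vs. joining_path V E x vs y"
proof -
  have G: "finite_graph V E" and C: "connected_graph V E"
    using assms(1) by (auto simp: finite_tree_def)
  let ?P = "\<lambda>vs. simple_path V E (hd vs) vs (last vs) \<and> hd vs \<in> carrier_of x \<and> last vs \<in> carrier_of y"
  obtain a b where "a \<in> carrier_of x" "b \<in> carrier_of y" "a \<in> V" "b \<in> V"
    using realization_carrier[OF G assms(2)] realization_carrier[OF G assms(3)] by blast
  then obtain vs0 where "?P vs0"
    using C by (metis connected_graph_def simple_path_def)
  then obtain vs where P: "?P vs" and min: "\<And>ws. ?P ws \<Longrightarrow> length vs \<le> length ws"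
    using arg_min_nat_lemma[of ?P vs0 length] by blast
  have "c = hd vs" if c: "c \<in> set vs" "c \<in> carrier_of x" for c
  proof (rule ccontr)
    assume ne: "c \<noteq> hd vs"
    obtain p s where ps: "vs = p @ c # s" using c by (meson split_list)
    then have "p \<noteq> []" using ne by auto
    have "?P (c # s)"
      using P ps c by (auto simp: simple_path_def successively_append_iff)
    then show False using min[of "c # s"] ps \<open>p \<noteq> []\<close> by simp
  qed
  moreover have "c = last vs" if c: "c \<in> set vs" "c \<in> carrier_of y" for c
  proof (rule ccontr)
    assume ne: "c \<noteq> last vs"
    obtain p s where ps: "vs = (p @ [c]) @ s" using c by (metis append.assoc append_Cons append_Nil split_list)
    then have "s \<noteq> []" using ne by auto
    have "hd (p @ [c]) = hd vs" using ps by (cases p) auto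
    then have "?P (p @ [c])"
      using P c unfolding ps simple_path_def by (auto simp: successively_append_iff)
    then show False using min[of "p @ [c]"] ps \<open>s \<noteq> []\<close> by simp
  qed
  moreover have "hd vs \<in> set vs" "last vs \<in> set vs"
    using P by (auto simp: simple_path_def)
  ultimately have "joining_path V E x vs y"
    using P unfolding joining_path_def by blast
  then show ?thesis by blast
qed

lemma joining_path_rev:
  assumes "joining_path V E x vs y"
  shows "joining_path V E y (rev vs) x"
  using assms unfolding joining_path_def simple_path_def
  by (auto simp: hd_rev last_rev insert_commute)

lemma joining_path_unique:
  assumes T: "finite_tree V E" and x: "x \<in> realization V E" and y: "y \<in> realization V E"
    and ne: "carrier_of x \<noteq> carrier_of y"
    and J: "joining_path V E x vs y" "joining_path V E x ws y"
  shows "vs = ws"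
proof -
  have G: "finite_graph V E" and A: "\<nexists>vs. graph_cycle V E vs"
    using T by (auto simp: finite_tree_def)
  note cx = realization_carrier[OF G x] and cy = realization_carrier[OF G y]
  have Pv: "simple_path V E (hd vs) vs (last vs)" and Pw: "simple_path V E (hd ws) ws (last ws)"
    using J by (auto simp: joining_path_def)
  have inx: "c \<in> set vs \<Longrightarrow> c \<in> carrier_of x \<Longrightarrow> c = hd vs"
    and iny: "c \<in> set vs \<Longrightarrow> c \<in> carrier_of y \<Longrightarrow> c = last vs"
    and inx': "c \<in> set ws \<Longrightarrow> c \<in> carrier_of x \<Longrightarrow> c = hd ws"
    and iny': "c \<in> set ws \<Longrightarrow> c \<in> carrier_of y \<Longrightarrow> c = last ws" for c
    using J by (auto simp: joining_path_def)
  have h: "hd vs \<in> carrier_of x" "hd ws \<in> carrier_of x" "last vs \<in> carrier_of y" "last ws \<in> carrier_of y"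
    and m: "hd vs \<in> set vs" "last vs \<in> set vs" "hd ws \<in> set ws" "last ws \<in> set ws"
    using J by (auto simp: joining_path_def)
  have hV: "hd vs \<in> V" "hd ws \<in> V" "last vs \<in> V" "last ws \<in> V"
    using h cx(1) cy(1) by auto
  show ?thesis
  proof (cases "hd vs = hd ws")
    case hd: True
    show ?thesis
    proof (cases "last vs = last ws")
      case True
      then show ?thesis using simple_path_unique[OF A Pv] Pw hd by simp
    next
      case False
      then have e: "{last vs, last ws} \<in> E" using cy(4) h by blast
      have "last ws \<notin> set vs" using iny[of "last ws"] h False by auto
      then have "simple_path V E (hd vs) (vs @ [last ws]) (last ws)"
        using simple_path_snoc[OF Pv e] hV by blast
      then have "vs @ [last ws] = ws" using simple_path_unique[OF A] Pw hd by simp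
      then have "last vs \<in> set ws" using m by (metis UnI1 set_append)
      then show ?thesis using iny'[of "last vs"] h False by auto
    qed
  next
    case hd: False
    then have ex: "carrier_of x = {hd ws, hd vs}" and e: "{hd ws, hd vs} \<in> E"
      using cx(4)[OF h(2) h(1)] by simp_all
    have nin: "hd ws \<notin> set vs" using inx[of "hd ws"] h hd by auto
    have nin': "hd vs \<notin> set ws" using inx'[of "hd vs"] h hd by auto
    have Q: "simple_path V E (hd ws) (hd ws # vs) (last vs)"
      using simple_path_Cons[OF Pv e] nin hV by blast
    show ?thesis
    proof (cases "last vs = last ws")
      case True
      then have "hd ws # vs = ws" using simple_path_unique[OF A Q] Pw by simp
      then show ?thesis using m nin' by (metis list.set_intros(2))
    next
      case False
      then have ey: "carrier_of y = {last vs, last ws}" and e2: "{last vs, last ws} \<in> E"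
        using cy(4)[OF h(3) h(4)] by simp_all
      have nl: "last ws \<notin> set vs" using iny[of "last ws"] h False by auto
      show ?thesis
      proof (cases "last ws = hd ws")
        case True
        have "hd vs \<noteq> last vs" using True ex ey ne by auto
        then have "length vs \<ge> 2" using m by (cases vs; cases "tl vs") auto
        then have "graph_cycle V E (hd ws # vs)"
          using Q e2 True unfolding graph_cycle_def simple_path_def by auto
        then show ?thesis using A by blast
      next
        case False
        then have "simple_path V E (hd ws) ((hd ws # vs) @ [last ws]) (last ws)"
          using simple_path_snoc[OF Q e2] nl hV by auto
        then have "(hd ws # vs) @ [last ws] = ws" using simple_path_unique[OF A] Pw by blast
        then have "hd vs \<in> set ws" using m by (metis UnI1 list.set_intros(2) set_append)
        then show ?thesis using nin' by blast
      qed
    qed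
  qed
qed

lemma joining_path_ex1:
  assumes "finite_tree V E" "x \<in> realization V E" "y \<in> realization V E"
    and "carrier_of x \<noteq> carrier_of y"
  shows "\<exists>!vs. joining_path V E x vs y"
  using joining_path_exists[OF assms(1-3)] joining_path_unique[OF assms] by blast

lemma tree_dist_eq:
  assumes "finite_tree V E" "x \<in> realization V E" "y \<in> realization V E"
    and "carrier_of x \<noteq> carrier_of y" "joining_path V E x vs y"
  shows "tree_dist V E w x y = portion w x (hd vs) + path_weight w vs + portion w y (last vs)"
proof -
  have "(THE vs. joining_path V E x vs y) = vs"
    using joining_path_ex1[OF assms(1-4)] assms(5) by (rule the1_equality)
  then show ?thesis using assms(4) by (simp add: tree_dist_def)
qed

text \<open>On vertices, the distance is the total weight of the simple path joining them.\<close>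

lemma tree_dist_vertices:
  assumes T: "finite_tree V E" and P: "simple_path V E u vs v"
  shows "tree_dist V E w (indicator {u}) (indicator {v}) = path_weight w vs"
proof (cases "u = v")
  case True
  have "vs = [u]"
    using P True by (cases vs) (auto simp: simple_path_def split: if_splits)
  moreover have "carrier_of (indicator {v} :: _ \<Rightarrow> real) = {v}"
    by (auto simp: carrier_of_def indicator_def)
  ultimately show ?thesis using True by (simp add: tree_dist_def segment_length_def)
next
  case False
  have c: "carrier_of (indicator {z} :: _ \<Rightarrow> real) = {z}" for z :: 'a
    by (auto simp: carrier_of_def indicator_def)
  have "hd vs \<in> set vs" "last vs \<in> set vs" "u \<in> V" "v \<in> V"
    using P by (auto simp: simple_path_def)
  then have "joining_path V E (indicator {u}) vs (indicator {v})"
    using P by (auto simp: joining_path_def c simple_path_def)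
  moreover have "(indicator {z} :: 'a \<Rightarrow> real) \<in> realization V E" if "z \<in> V" for z
    using that by (auto simp: realization_def c)
  ultimately show ?thesis
    using tree_dist_eq[OF T, of "indicator {u}" "indicator {v}" vs w] False P \<open>u \<in> V\<close> \<open>v \<in> V\<close>
    by (auto simp: c portion_def simple_path_def)
qed

end

theory Submission
  imports Defs
begin

text \<open>
  Let \<open>f\<close> be an isometric embedding.  The maximum metric is attained in some coordinate, so for
  any two leaves \<open>l\<close> and \<open>l'\<close> some coordinate of \<open>f\<close> changes by the full distance from \<open>l\<close> to
  \<open>l'\<close>.  As every coordinate is 1-Lipschitz, this one must be monotone along the whole path from
  \<open>l\<close> to \<open>l'\<close>: if it rises when the path leaves \<open>l\<close>, it still rises when the path arrives at \<open>l'\<close>.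
  Hence, if the edges at \<open>l\<close> and at \<open>l'\<close> are both directed towards their leaves, this coordinate
  falls along one of them and rises along the other.

  So attach to each leaf the set of those coordinates that rise along its edge towards the leaf.
  Different leaves get different subsets of the \<open>n\<close> coordinates, and there are at most \<open>2 ^ n\<close>
  leaves.

  Monotonicity need only be seen on the leaf edge, hence at two vertices: the step from a leaf to
  its neighbour gets strictly closer to every other vertex (\<open>leaf_neighbour_closer\<close>), and the
  count is then a fact about points of \<open>\<real>\<^sup>n\<close> (\<open>card_le_of_approaching_points\<close>).
\<close>

lemma abs_coordinate_diff_le_max_dist:
  fixes x y :: "real ^ 'n"
  shows "\<bar>x $ i - y $ i\<bar> \<le> max_dist x y"
  unfolding max_dist_def by (rule Max_ge) auto

lemma max_dist_attained:
  fixes x y :: "real ^ 'n"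
  obtains i where "max_dist x y = \<bar>x $ i - y $ i\<bar>"
proof -
  have "max_dist x y \<in> range (\<lambda>i. \<bar>x $ i - y $ i\<bar>)"
    unfolding max_dist_def by (rule Max_in) auto
  then show ?thesis using that by blast
qed

lemma max_dist_commute:
  fixes x y :: "real ^ 'n"
  shows "max_dist x y = max_dist y x"
  by (simp add: max_dist_def abs_minus_commute)

text \<open>
  A coordinate that realizes the distance from \<open>x\<close> to \<open>y\<close> has to move towards \<open>y\<close> when \<open>x\<close> is
  replaced by a closer point \<open>z\<close>; otherwise \<open>z\<close> would be at least as far away as \<open>x\<close> in this
  coordinate.
\<close>

lemma realizing_coordinate_moves_towards:
  fixes x y z :: "real ^ 'n"
  assumes "max_dist z y < max_dist x y" and "max_dist x y = \<bar>x $ i - y $ i\<bar>"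
  shows "x $ i < y $ i \<Longrightarrow> x $ i < z $ i" and "y $ i < x $ i \<Longrightarrow> z $ i < x $ i"
  using assms abs_coordinate_diff_le_max_dist[of z i y] by linarith+

text \<open>
  Think of \<open>q l\<close> as a point inward from the extremity \<open>p l\<close>.  Being extremal in this sense,
  each \<open>p l\<close> is identified by the set of coordinates in which it exceeds \<open>q l\<close>.
\<close>

lemma card_le_of_approaching_points:
  fixes p q :: "'b \<Rightarrow> real ^ 'n"
  assumes closer: "\<And>l l'. l \<in> L \<Longrightarrow> l' \<in> L \<Longrightarrow> l \<noteq> l' \<Longrightarrow>
      max_dist (q l) (p l') < max_dist (p l) (p l')"
  shows "card L \<le> 2 ^ CARD('n)"
proof -
  define rising where "rising l = {i. q l $ i < p l $ i}" for l
  have "inj_on rising L"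
  proof (rule inj_onI, rule ccontr)
    fix l l'
    assume L: "l \<in> L" "l' \<in> L" and eq: "rising l = rising l'" and ne: "l \<noteq> l'"
    have near: "max_dist (q l) (p l') < max_dist (p l) (p l')"
      and near': "max_dist (q l') (p l) < max_dist (p l') (p l)"
      using closer L ne by auto
    obtain i where i: "max_dist (p l) (p l') = \<bar>p l $ i - p l' $ i\<bar>"
      by (rule max_dist_attained)
    then have i': "max_dist (p l') (p l) = \<bar>p l' $ i - p l $ i\<bar>"
      by (simp add: max_dist_commute abs_minus_commute)
    have "p l $ i \<noteq> p l' $ i"
      using near i abs_coordinate_diff_le_max_dist[of "q l" i "p l'"] by auto
    then consider "p l $ i < p l' $ i" | "p l' $ i < p l $ i" by linarith
    then have "i \<in> rising l \<longleftrightarrow> i \<notin> rising l'"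
      using realizing_coordinate_moves_towards[OF near i]
        realizing_coordinate_moves_towards[OF near' i']
      by cases (auto simp: rising_def)
    then show False using eq by simp
  qed
  then have "card L \<le> card (UNIV :: 'n set set)"
    by (rule card_inj_on_le) auto
  then show ?thesis by (simp add: card_UNIV_set)
qed


lemma leaf_unique_neighbour:
  assumes "finite_graph V E" and "l \<in> leaves V E"
  shows "\<exists>b\<in>V. \<forall>a. {l, a} \<in> E \<longrightarrow> a = b"
proof -
  have "card {e \<in> E. l \<in> e} = 1"
    using assms(2) by (simp add: leaves_def vertex_degree_def)
  then obtain e where e: "{e \<in> E. l \<in> e} = {e}"
    by (rule card_1_singletonE)
  then have "e \<in> E" "l \<in> e" by auto
  then have "card e = 2" and "e \<subseteq> V" using assms(1) by (auto simp: finite_graph_def)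
  then obtain x y where "e = {x, y}" by (auto simp: card_2_iff)
  with \<open>l \<in> e\<close> obtain b where b: "e = {l, b}" by auto
  have "a = b" if "{l, a} \<in> E" for a
  proof -
    have "{l, a} \<in> {e \<in> E. l \<in> e}" using that by simp
    then have "{l, a} = e" unfolding e by simp
    then show ?thesis using b by (auto simp: doubleton_eq_iff)
  qed
  then show ?thesis using b \<open>e \<subseteq> V\<close> by blast
qed

text \<open>
  The path from a leaf to any other vertex has to begin with the only edge at the leaf, and the
  rest of it is the path from the neighbour.
\<close>

lemma leaf_neighbour_closer:
  assumes T: "finite_tree V E" and pos: "\<forall>e\<in>E. w e > 0" and l: "l \<in> leaves V E"
  shows "\<exists>b\<in>V. \<forall>u\<in>V. u \<noteq> l \<longrightarrow>
      tree_dist V E w (indicator {b}) (indicator {u}) < tree_dist V E w (indicator {l}) (indicator {u})"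
proof -
  have lV: "l \<in> V" using l by (simp add: leaves_def)
  have G: "finite_graph V E" using T by (simp add: finite_tree_def)
  obtain b where bV: "b \<in> V" and b: "\<And>a. {l, a} \<in> E \<Longrightarrow> a = b"
    using leaf_unique_neighbour[OF G l] by blast
  have "tree_dist V E w (indicator {b}) (indicator {u}) < tree_dist V E w (indicator {l}) (indicator {u})"
    if u: "u \<in> V" "u \<noteq> l" for u
  proof -
    obtain vs where vs: "simple_path V E l vs u"
      using T lV u(1) unfolding finite_tree_def connected_graph_def by blast
    then obtain a as where eq: "vs = l # a # as"
      using u(2) by (cases vs; cases "tl vs") (auto simp: simple_path_def)
    have e: "{l, a} \<in> E" and rest: "simple_path V E a (a # as) u"
      using vs eq by (auto simp: simple_path_def)
    have "tree_dist V E w (indicator {l}) (indicator {u}) =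
        w {l, a} + tree_dist V E w (indicator {a}) (indicator {u})"
      using tree_dist_vertices[OF T vs] tree_dist_vertices[OF T rest] eq by simp
    then show ?thesis using pos e b[OF e] by auto
  qed
  then show ?thesis using bV by blast
qed

lemma vertex_in_realization:
  assumes "v \<in> V"
  shows "(indicator {v} :: 'a \<Rightarrow> real) \<in> realization V E"
proof -
  have "carrier_of (indicator {v} :: 'a \<Rightarrow> real) = {v}"
    by (auto simp: carrier_of_def indicator_def)
  then show ?thesis using assms by (auto simp: realization_def)
qed


theorem proposition4p4:
  fixes V :: "'a set" and E :: "'a set set" and w :: "'a set \<Rightarrow> real"
  assumes "finite_metric_tree V E w"
    and "card (leaves V E) > 2 ^ CARD('n::finite)"
  shows "\<not> (\<exists>f :: ('a \<Rightarrow> real) \<Rightarrow> real ^ 'n.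
           isometric_embedding (realization V E) (tree_dist V E w) max_dist f)"
proof
  assume "\<exists>f :: ('a \<Rightarrow> real) \<Rightarrow> real ^ 'n.
           isometric_embedding (realization V E) (tree_dist V E w) max_dist f"
  then obtain f :: "('a \<Rightarrow> real) \<Rightarrow> real ^ 'n" where
    f: "isometric_embedding (realization V E) (tree_dist V E w) max_dist f" by blast
  define g where "g v = f (indicator {v})" for v
  have dist: "max_dist (g u) (g v) = tree_dist V E w (indicator {u}) (indicator {v})"
    if "u \<in> V" "v \<in> V" for u v
    using f that by (simp add: g_def isometric_embedding_def vertex_in_realization)
  have T: "finite_tree V E" and pos: "\<forall>e\<in>E. w e > 0"
    using assms(1) by (auto simp: finite_metric_tree_def)
  have "\<exists>b. \<forall>u\<in>V. u \<noteq> l \<longrightarrow> max_dist (g b) (g u) < max_dist (g l) (g u)"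
    if l: "l \<in> leaves V E" for l
  proof -
    have "l \<in> V" using l by (simp add: leaves_def)
    obtain b where "b \<in> V" and "\<forall>u\<in>V. u \<noteq> l \<longrightarrow>
        tree_dist V E w (indicator {b}) (indicator {u}) < tree_dist V E w (indicator {l}) (indicator {u})"
      using leaf_neighbour_closer[OF T pos l] by blast
    then have "\<forall>u\<in>V. u \<noteq> l \<longrightarrow> max_dist (g b) (g u) < max_dist (g l) (g u)"
      using \<open>l \<in> V\<close> by (simp add: dist)
    then show ?thesis by blast
  qed
  then obtain b where
    "\<forall>l\<in>leaves V E. \<forall>u\<in>V. u \<noteq> l \<longrightarrow> max_dist (g (b l)) (g u) < max_dist (g l) (g u)"
    by metis
  then have "card (leaves V E) \<le> 2 ^ CARD('n)"
    by (intro card_le_of_approaching_points[of _ "\<lambda>l. g (b l)" g]) (auto simp: leaves_def)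
  then show False using assms(2) by simp
qed

end
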